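(* Let $k\in\mathbb{N}$ and let $A$ be a nonempty finite set. For all $\mathcal{F}'\subseteq\mathcal{F}\subseteq \mathcal{O}_A^k$ and all $S'\subseteq S \subseteq R_A^k$ we have \[\mathrm{Inv}\,\mathcal{F} \subseteq \mathrm{Inv}\,\mathcal{F}',\quad \mathcal{F}\subseteq\mathrm{sPol}\,\mathrm{Inv}\,\mathcal{F},\quad \mathrm{Inv}\,\mathrm{sPol}\,\mathrm{Inv}\,\mathcal{F} = \mathrm{Inv}\,\mathcal{F},\] \[\mathrm{sPol}\, S \subseteq \mathrm{sPol}\, S',\quad S\subseteq\mathrm{Inv}\,\mathrm{sPol}\, S,\quad \mathrm{sPol}\,\mathrm{Inv}\,\mathrm{sPol}\, S = \mathrm{sPol}\, S,\] and moreover \[\mathrm{sPol}\,\mathrm{Inv}\, \mathcal{F} = \mathrm{sClo}\,\mathcal{F},\qquad \mathrm{Inv}\,\mathrm{sPol}\, S = \langle S\rangle_{\mathrm{qpp}}.\]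
   Context: $\mathbb{N}=\{1,2,\dots\}$, $\mathbb{N}_0=\mathbb{N}\cup\{0\}$, $E_k=\{1,\dots,k\}$. A $k$-operation of arity $n$ on $A$ is a $k$-tuple $\boldsymbol f=(\boldsymbol f^{(1)},\dots,\boldsymbol f^{(k)})$ of functions $A^n\to A$; $\mathcal{O}_A^k$ is the set of all finitary $k$-operations on $A$. Composition is coordinatewise: for $m$-ary $\boldsymbol f$ and $n$-ary $\boldsymbol g_1,\dots,\boldsymbol g_m$, $\boldsymbol h^{(i)}(x_1,\dots,x_n)=\boldsymbol f^{(i)}(\boldsymbol g_1^{(i)}(x_1,\dots,x_n),\dots,\boldsymbol g_m^{(i)}(x_1,\dots,x_n))$ for all $i\in E_k$. A $k$-clone is a set of $k$-operations closed under composition and containing all $k$-projections $\boldsymbol p^k_{n,i}$ (each component is $(x_1,\dots,x_n)\mapsto x_i$). $\mathrm{Clo}\,\mathcal{F}$ is the smallest $k$-clone containing $\mathcal F$, and $\mathrm{sClo}\,\mathcal F$ is the set of surjective members of $\mathrm{Clo}\,\mathcal F$, where $\boldsymbol f$ is surjective if every $\boldsymbol f^{(i)}$ is surjective. A $k$-sorted relation of arity $n\in\mathbb N_0$ on $A$ is a subset of $A^n$ in which each coordinate (variable) is assigned a sort in $E_k$; $R_A^k$ is the set of all of them. Let $\sigma_\bot$ be the empty $0$-ary relation and $\sigma_=^i$ the binary equality relation with both variables of sort $i$. For $S\subseteq R_A^k$, $\langle S\rangle_{\mathrm{qpp}}$ is the set of all $k$-sorted relations definable by a first-order formula built from predicates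 in $S\cup\{\sigma_\bot,\sigma_=^1,\dots,\sigma_=^k\}$ using only conjunction, existential quantification and universal quantification (quantifiers range over $A$), where every variable of the formula has a single sort and is substituted only into positions of that sort. An $m$-ary $k$-operation $\boldsymbol f$ preserves an $n$-ary $k$-sorted relation $\rho$ whose $j$-th variable has sort $r_j$ if for all $\boldsymbol a_1,\dots,\boldsymbol a_m\in\rho$ the tuple whose $j$-th entry is $\boldsymbol f^{(r_j)}(\boldsymbol a_1(j),\dots,\boldsymbol a_m(j))$ lies in $\rho$. $\mathrm{Inv}\,\mathcal F$ is the set of relations in $R_A^k$ preserved by all members of $\mathcal F$; $\mathrm{sPol}\, S$ is the set of surjective $k$-operations preserving all relations in $S$.
   Formalization: The claims F ⊆ sPol Inv F and Inv sPol Inv F = Inv F are stated only when every member of F is surjective; as printed both fail, e.g. for k=1, A={0,1}, F={constant 0}. All other claims are for arbitrary F. *)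

theory Defs
  imports "HOL-Library.FuncSet"
begin

definition tuples :: "'a set \<Rightarrow> nat \<Rightarrow> 'a list set" where
  "tuples A n = {xs. length xs = n \<and> set xs \<subseteq> A}"

text \<open>
  A \<open>k\<close>-operation is a pair of its arity and a function assigning to each sort \<open>i \<in> {1..k}\<close>
  its \<open>i\<close>-th component. Components are extensional, so that two \<open>k\<close>-operations are equal
  iff they have the same arity and agree on all tuples. Arities are positive.
\<close>

type_synonym 'a kop = "nat \<times> (nat \<Rightarrow> 'a list \<Rightarrow> 'a)"

definition kops :: "nat \<Rightarrow> 'a set \<Rightarrow> 'a kop set" where
  "kops k A = {(n, f). n \<ge> 1 \<and> f \<in> {1..k} \<rightarrow>\<^sub>E (tuples A n \<rightarrow>\<^sub>E A)}"

definition ksurj :: "nat \<Rightarrow> 'a set \<Rightarrow> 'a kop \<Rightarrow> bool" where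
  "ksurj k A f \<longleftrightarrow> (\<forall>i\<in>{1..k}. snd f i ` tuples A (fst f) = A)"

text \<open>The projection to the \<open>j\<close>-th argument, \<open>1 \<le> j \<le> n\<close>; list positions start at \<open>0\<close>.\<close>

definition kproj :: "nat \<Rightarrow> 'a set \<Rightarrow> nat \<Rightarrow> nat \<Rightarrow> 'a kop" where
  "kproj k A n j = (n, \<lambda>i\<in>{1..k}. \<lambda>xs\<in>tuples A n. xs ! (j - 1))"

definition kcompose :: "nat \<Rightarrow> 'a set \<Rightarrow> nat \<Rightarrow> 'a kop \<Rightarrow> 'a kop list \<Rightarrow> 'a kop" where
  "kcompose k A n f gs =
     (n, \<lambda>i\<in>{1..k}. \<lambda>xs\<in>tuples A n. snd f i (map (\<lambda>g. snd g i xs) gs))"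

definition kclone :: "nat \<Rightarrow> 'a set \<Rightarrow> 'a kop set \<Rightarrow> bool" where
  "kclone k A C \<longleftrightarrow>
     C \<subseteq> kops k A \<and>
     (\<forall>n\<ge>1. \<forall>j\<in>{1..n}. kproj k A n j \<in> C) \<and>
     (\<forall>n\<ge>1. \<forall>f\<in>C. \<forall>gs. length gs = fst f \<and> set gs \<subseteq> C \<and> (\<forall>g\<in>set gs. fst g = n)
        \<longrightarrow> kcompose k A n f gs \<in> C)"

definition Clo :: "nat \<Rightarrow> 'a set \<Rightarrow> 'a kop set \<Rightarrow> 'a kop set" where
  "Clo k A F = \<Inter> {C. kclone k A C \<and> F \<subseteq> C}"

definition sClo :: "nat \<Rightarrow> 'a set \<Rightarrow> 'a kop set \<Rightarrow> 'a kop set" where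
  "sClo k A F = {f \<in> Clo k A F. ksurj k A f}"

text \<open>
  A \<open>k\<close>-sorted relation is a pair of the list of sorts of its coordinates and a set of tuples;
  its arity is the length of the sort list. The sorts are part of the relation, so empty
  relations with different sort lists are different.
\<close>

type_synonym 'a krel = "nat list \<times> 'a list set"

definition krels :: "nat \<Rightarrow> 'a set \<Rightarrow> 'a krel set" where
  "krels k A = {(r, R). set r \<subseteq> {1..k} \<and> R \<subseteq> tuples A (length r)}"

definition kpreserves :: "'a kop \<Rightarrow> 'a krel \<Rightarrow> bool" where
  "kpreserves f \<rho> \<longleftrightarrow>
     (\<forall>as. length as = fst f \<and> set as \<subseteq> snd \<rho> \<longrightarrow>
        map (\<lambda>j. snd f (fst \<rho> ! j) (map (\<lambda>a. a ! j) as)) [0..<length (fst \<rho>)] \<in> snd \<rho>)"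

definition Inv :: "nat \<Rightarrow> 'a set \<Rightarrow> 'a kop set \<Rightarrow> 'a krel set" where
  "Inv k A F = {\<rho> \<in> krels k A. \<forall>f\<in>F. kpreserves f \<rho>}"

definition sPol :: "nat \<Rightarrow> 'a set \<Rightarrow> 'a krel set \<Rightarrow> 'a kop set" where
  "sPol k A S = {f \<in> kops k A. ksurj k A f \<and> (\<forall>\<rho>\<in>S. kpreserves f \<rho>)}"

definition sigma_bot :: "'a krel" where
  "sigma_bot = ([], {})"

definition sigma_eq :: "'a set \<Rightarrow> nat \<Rightarrow> 'a krel" where
  "sigma_eq A i = ([i, i], {[a, a] | a. a \<in> A})"

text \<open>Formulas, with natural numbers as variables and relations serving as their own symbols.\<close>

datatype 'a qpp =
    Atom "nat list \<times> 'a list set" "nat list"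
  | Conj "'a qpp" "'a qpp"
  | Exists nat "'a qpp"
  | Forall nat "'a qpp"

primrec qpp_preds :: "'a qpp \<Rightarrow> 'a krel set" where
  "qpp_preds (Atom \<rho> xs) = {\<rho>}"
| "qpp_preds (Conj \<phi> \<psi>) = qpp_preds \<phi> \<union> qpp_preds \<psi>"
| "qpp_preds (Exists x \<phi>) = qpp_preds \<phi>"
| "qpp_preds (Forall x \<phi>) = qpp_preds \<phi>"

primrec qpp_free :: "'a qpp \<Rightarrow> nat set" where
  "qpp_free (Atom \<rho> xs) = set xs"
| "qpp_free (Conj \<phi> \<psi>) = qpp_free \<phi> \<union> qpp_free \<psi>"
| "qpp_free (Exists x \<phi>) = qpp_free \<phi> - {x}"
| "qpp_free (Forall x \<phi>) = qpp_free \<phi> - {x}"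

text \<open>
  Here \<open>s\<close> is the assignment of sorts to variables. The atomic case also forces the number of
  variables to be the arity of the predicate.
\<close>

primrec qpp_sorted :: "(nat \<Rightarrow> nat) \<Rightarrow> 'a qpp \<Rightarrow> bool" where
  "qpp_sorted s (Atom \<rho> xs) \<longleftrightarrow> map s xs = fst \<rho>"
| "qpp_sorted s (Conj \<phi> \<psi>) \<longleftrightarrow> qpp_sorted s \<phi> \<and> qpp_sorted s \<psi>"
| "qpp_sorted s (Exists x \<phi>) \<longleftrightarrow> qpp_sorted s \<phi>"
| "qpp_sorted s (Forall x \<phi>) \<longleftrightarrow> qpp_sorted s \<phi>"

primrec qpp_holds :: "'a set \<Rightarrow> 'a qpp \<Rightarrow> (nat \<Rightarrow> 'a) \<Rightarrow> bool" where
  "qpp_holds A (Atom \<rho> xs) v \<longleftrightarrow> map v xs \<in> snd \<rho>"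
| "qpp_holds A (Conj \<phi> \<psi>) v \<longleftrightarrow> qpp_holds A \<phi> v \<and> qpp_holds A \<psi> v"
| "qpp_holds A (Exists x \<phi>) v \<longleftrightarrow> (\<exists>a\<in>A. qpp_holds A \<phi> (v(x := a)))"
| "qpp_holds A (Forall x \<phi>) v \<longleftrightarrow> (\<forall>a\<in>A. qpp_holds A \<phi> (v(x := a)))"

text \<open>
  The relation defined by \<open>\<phi>(y\<^sub>1,\<dots>,y\<^sub>n)\<close> with \<open>ys = [y\<^sub>1,\<dots>,y\<^sub>n]\<close> distinct variables that
  include all free variables of \<open>\<phi>\<close>; its coordinates inherit the sorts of these variables.
\<close>

definition qpp_closure :: "nat \<Rightarrow> 'a set \<Rightarrow> 'a krel set \<Rightarrow> 'a krel set" where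
  "qpp_closure k A S =
     {(map s ys, {map v ys | v. range v \<subseteq> A \<and> qpp_holds A \<phi> v}) | \<phi> s ys.
        range s \<subseteq> {1..k} \<and> qpp_sorted s \<phi> \<and>
        qpp_preds \<phi> \<subseteq> S \<union> {sigma_bot} \<union> sigma_eq A ` {1..k} \<and>
        distinct ys \<and> qpp_free \<phi> \<subseteq> set ys}"

end

theory Submission
  imports Defs
begin

text \<open>
  For the last equality, list the tuples \<open>b\<close> of an invariant relation together with all maps
  \<open>z : {1..k} \<times> A \<rightarrow> A\<close> as \<open>(b\<^sub>1, z\<^sub>1), \<dots>, (b\<^sub>M, z\<^sub>M)\<close> and describe the value table of an unknown
  \<open>M\<close>-ary polymorphism \<open>g\<close> by one variable for each sort and each argument tuple. Requiring that
  \<open>g(b\<^sub>1, \<dots>, b\<^sub>M)\<close> is the given tuple, and quantifying universally over the entries of the table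
  at the arguments \<open>(z\<^sub>1(i, a), \<dots>, z\<^sub>M(i, a))\<close> of sort \<open>i\<close> and existentially over the others,
  defines the relation: some choice of the universally quantified values forces \<open>g\<close> to be
  surjective, while every choice is realised by a projection that moreover maps
  \<open>(b\<^sub>1, \<dots>, b\<^sub>M)\<close> to any prescribed tuple of the relation.
\<close>

section \<open>Tuples and operations over \<open>A\<close>\<close>

lemma tuples_map_nth:
  assumes "set as \<subseteq> tuples A n" "j < n"
  shows "map (\<lambda>a. a ! j) as \<in> tuples A (length as)"
  using assms by (fastforce simp: tuples_def)

lemma finite_tuples: "finite A \<Longrightarrow> finite (tuples A n)"
  unfolding tuples_def using finite_lists_length_eq[of A n] by (simp add: conj_commute)

lemma kops_in:
  assumes "f \<in> kops k A" "i \<in> {1..k}" "xs \<in> tuples A (fst f)"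
  shows "snd f i xs \<in> A"
  using assms by (auto simp: kops_def PiE_def Pi_def)

lemma kops_arity: "f \<in> kops k A \<Longrightarrow> 1 \<le> fst f"
  by (auto simp: kops_def)

lemma kopsI:
  assumes "1 \<le> n" "\<And>i xs. i \<in> {1..k} \<Longrightarrow> xs \<in> tuples A n \<Longrightarrow> f i xs \<in> A"
  shows "(n, \<lambda>i\<in>{1..k}. \<lambda>xs\<in>tuples A n. f i xs) \<in> kops k A"
  using assms by (auto simp: kops_def)

lemma kop_eqI:
  assumes "f \<in> kops k A" "g \<in> kops k A" "fst f = fst g"
    and eq: "\<And>i xs. i \<in> {1..k} \<Longrightarrow> xs \<in> tuples A (fst f) \<Longrightarrow> snd f i xs = snd g i xs"
  shows "f = g"
proof -
  have f: "snd f \<in> {1..k} \<rightarrow>\<^sub>E (tuples A (fst f) \<rightarrow>\<^sub>E A)"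
    and g: "snd g \<in> {1..k} \<rightarrow>\<^sub>E (tuples A (fst f) \<rightarrow>\<^sub>E A)"
    using assms(1-3) by (simp_all add: kops_def case_prod_beta)
  have "snd f = snd g"
  proof (rule PiE_ext[OF f g])
    fix i assume i: "i \<in> {1..k}"
    show "snd f i = snd g i"
      by (rule PiE_ext[OF PiE_mem[OF f i] PiE_mem[OF g i]]) (rule eq[OF i])
  qed
  then show ?thesis using assms(3) by (simp add: prod_eq_iff)
qed

lemma finite_kops_arity:
  assumes "finite A"
  shows "finite {f \<in> kops k A. fst f = n}"
proof (rule finite_subset)
  show "{f \<in> kops k A. fst f = n} \<subseteq> {n} \<times> ({1..k} \<rightarrow>\<^sub>E (tuples A n \<rightarrow>\<^sub>E A))"
    by (clarsimp simp: kops_def simp del: PiE_iff)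
  show "finite ({n} \<times> ({1..k} \<rightarrow>\<^sub>E (tuples A n \<rightarrow>\<^sub>E A)))"
    by (intro finite_cartesian_product finite_PiE finite_tuples assms) auto
qed

lemma kpreservesD:
  assumes "kpreserves f \<rho>" "length as = fst f" "set as \<subseteq> snd \<rho>"
  shows "map (\<lambda>j. snd f (fst \<rho> ! j) (map (\<lambda>a. a ! j) as)) [0..<length (fst \<rho>)] \<in> snd \<rho>"
  using assms by (auto simp: kpreserves_def)

lemma kproj_in_kops:
  assumes "1 \<le> n" "j \<in> {1..n}"
  shows "kproj k A n j \<in> kops k A"
  unfolding kproj_def by (rule kopsI) (use assms in \<open>auto simp: tuples_def\<close>)

lemma map_kops_in_tuples:
  assumes "set gs \<subseteq> kops k A" "\<forall>g\<in>set gs. fst g = n" "i \<in> {1..k}" "xs \<in> tuples A n"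
  shows "map (\<lambda>g. snd g i xs) gs \<in> tuples A (length gs)"
  using assms kops_in[of _ k A i xs] by (fastforce simp: tuples_def)

lemma kcompose_in_kops:
  assumes "1 \<le> n" "f \<in> kops k A" "length gs = fst f" "set gs \<subseteq> kops k A" "\<forall>g\<in>set gs. fst g = n"
  shows "kcompose k A n f gs \<in> kops k A"
  unfolding kcompose_def
proof (rule kopsI[OF assms(1)])
  fix i xs assume "i \<in> {1..k}" "xs \<in> tuples A n"
  then show "snd f i (map (\<lambda>g. snd g i xs) gs) \<in> A"
    using kops_in[OF assms(2)] map_kops_in_tuples[OF assms(4,5)] assms(3) by metis
qed

lemma krelsD:
  assumes "\<rho> \<in> krels k A"
  shows "snd \<rho> \<subseteq> tuples A (length (fst \<rho>))" "j < length (fst \<rho>) \<Longrightarrow> fst \<rho> ! j \<in> {1..k}"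
  using assms nth_mem[of j "fst \<rho>"] by (auto simp: krels_def subset_iff simp del: nth_mem)

section \<open>Operations preserving given relations form a clone\<close>

lemma kproj_preserves:
  assumes \<rho>: "\<rho> \<in> krels k A" and j: "j \<in> {1..n}"
  shows "kpreserves (kproj k A n j) \<rho>"
  unfolding kpreserves_def
proof (intro allI impI, elim conjE)
  fix as assume len: "length as = fst (kproj k A n j)" and as: "set as \<subseteq> snd \<rho>"
  have n: "length as = n" using len by (simp add: kproj_def)
  have mem: "as ! (j - 1) \<in> snd \<rho>" using as j n nth_mem[of "j - 1" as] by auto
  have "length (as ! (j - 1)) = length (fst \<rho>)"
    using mem krelsD(1)[OF \<rho>] by (auto simp: tuples_def)
  moreover have "snd (kproj k A n j) (fst \<rho> ! l) (map (\<lambda>a. a ! l) as) = as ! (j - 1) ! l"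
    if "l < length (fst \<rho>)" for l
  proof -
    have "map (\<lambda>a. a ! l) as \<in> tuples A n"
      using tuples_map_nth[of as A "length (fst \<rho>)" l] as krelsD(1)[OF \<rho>] that n by auto
    then show ?thesis using krelsD(2)[OF \<rho> that] j n by (auto simp: kproj_def)
  qed
  ultimately have "map (\<lambda>l. snd (kproj k A n j) (fst \<rho> ! l) (map (\<lambda>a. a ! l) as))
      [0..<length (fst \<rho>)] = as ! (j - 1)"
    by (intro nth_equalityI) auto
  then show "map (\<lambda>l. snd (kproj k A n j) (fst \<rho> ! l) (map (\<lambda>a. a ! l) as))
      [0..<length (fst \<rho>)] \<in> snd \<rho>" using mem by simp
qed

text \<open>The inner operations turn the given tuples into tuples of \<open>\<rho>\<close>, to
  which \<open>f\<close> is then applied; exchanging rows and columns shows that this is the action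
  of the composition.\<close>

lemma kcompose_preserves:
  assumes \<rho>: "\<rho> \<in> krels k A" and f: "kpreserves f \<rho>" "length gs = fst f"
    and gs: "\<forall>g\<in>set gs. fst g = n \<and> kpreserves g \<rho>"
  shows "kpreserves (kcompose k A n f gs) \<rho>"
  unfolding kpreserves_def
proof (intro allI impI, elim conjE)
  fix as assume len: "length as = fst (kcompose k A n f gs)" and as: "set as \<subseteq> snd \<rho>"
  have n: "length as = n" using len by (simp add: kcompose_def)
  let ?app = "\<lambda>g. map (\<lambda>j. snd g (fst \<rho> ! j) (map (\<lambda>a. a ! j) as)) [0..<length (fst \<rho>)]"
  have "?app g \<in> snd \<rho>" if "g \<in> set gs" for g
    by (rule kpreservesD) (use gs as n that in auto)
  then have "set (map ?app gs) \<subseteq> snd \<rho>" unfolding set_map by blast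
  from kpreservesD[OF f(1) _ this]
  have "map (\<lambda>j. snd f (fst \<rho> ! j) (map (\<lambda>a. a ! j) (map ?app gs))) [0..<length (fst \<rho>)] \<in> snd \<rho>"
    using f(2) by simp
  moreover have "snd (kcompose k A n f gs) (fst \<rho> ! j) (map (\<lambda>a. a ! j) as)
      = snd f (fst \<rho> ! j) (map (\<lambda>a. a ! j) (map ?app gs))" if "j < length (fst \<rho>)" for j
  proof -
    have "map (\<lambda>a. a ! j) as \<in> tuples A n"
      using tuples_map_nth[of as A "length (fst \<rho>)" j] as krelsD(1)[OF \<rho>] that n by auto
    then show ?thesis using krelsD(2)[OF \<rho> that] that by (auto simp: kcompose_def comp_def)
  qed
  then have "?app (kcompose k A n f gs)
      = map (\<lambda>j. snd f (fst \<rho> ! j) (map (\<lambda>a. a ! j) (map ?app gs))) [0..<length (fst \<rho>)]"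
    by (intro map_cong) auto
  ultimately show "?app (kcompose k A n f gs) \<in> snd \<rho>"
    by (simp only:)
qed

text \<open>Taken with \<open>S = {}\<close> this makes \<open>kops k A\<close> itself a clone;
  taken with \<open>S = Inv k A F\<close> it bounds \<open>Clo k A F\<close> from above.\<close>

lemma kclone_pol:
  assumes "S \<subseteq> krels k A"
  shows "kclone k A {f \<in> kops k A. \<forall>\<rho>\<in>S. kpreserves f \<rho>}"
  unfolding kclone_def
proof (intro conjI allI ballI impI)
  fix n j :: nat assume "1 \<le> n" "j \<in> {1..n}"
  then show "kproj k A n j \<in> {f \<in> kops k A. \<forall>\<rho>\<in>S. kpreserves f \<rho>}"
    using assms by (auto intro: kproj_in_kops kproj_preserves)
next
  fix n f gs
  assume "1 \<le> n" "f \<in> {f \<in> kops k A. \<forall>\<rho>\<in>S. kpreserves f \<rho>}"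
    "length gs = fst f \<and> set gs \<subseteq> {f \<in> kops k A. \<forall>\<rho>\<in>S. kpreserves f \<rho>} \<and> (\<forall>g\<in>set gs. fst g = n)"
  moreover from this have "kcompose k A n f gs \<in> kops k A"
    by (intro kcompose_in_kops) auto
  moreover have "kpreserves (kcompose k A n f gs) \<rho>" if "\<rho> \<in> S" for \<rho>
    by (rule kcompose_preserves[of \<rho> k A]) (use that assms calculation in auto)
  ultimately show "kcompose k A n f gs \<in> {f \<in> kops k A. \<forall>\<rho>\<in>S. kpreserves f \<rho>}"
    by simp
qed auto

lemma kclone_composeD:
  assumes "kclone k A C" "1 \<le> n" "f \<in> C" "length gs = fst f" "set gs \<subseteq> C" "\<forall>g\<in>set gs. fst g = n"
  shows "kcompose k A n f gs \<in> C"
  using assms(1)[unfolded kclone_def, THEN conjunct2, THEN conjunct2] assms(2-) by metis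

lemma Clo_least: "kclone k A C \<Longrightarrow> F \<subseteq> C \<Longrightarrow> Clo k A F \<subseteq> C"
  by (auto simp: Clo_def)

lemma Clo_superset: "F \<subseteq> Clo k A F"
  by (auto simp: Clo_def)

lemma kclone_Clo:
  assumes "F \<subseteq> kops k A"
  shows "kclone k A (Clo k A F)"
proof -
  \<comment> \<open>The family intersected in \<open>Clo\<close> has a member inside
    \<open>kops k A\<close>, so the intersection consists of genuine operations.\<close>
  have "kclone k A (kops k A)"
    using kclone_pol[of "{}" k A] by simp
  then have "Clo k A F \<subseteq> kops k A" using assms by (rule Clo_least)
  moreover have "kproj k A n j \<in> Clo k A F" if "1 \<le> n" "j \<in> {1..n}" for n j
    using that by (auto simp: Clo_def kclone_def)
  moreover have "kcompose k A n f gs \<in> Clo k A F"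
    if "1 \<le> n" "f \<in> Clo k A F" "length gs = fst f" "set gs \<subseteq> Clo k A F" "\<forall>g\<in>set gs. fst g = n"
    for n f gs
    unfolding Clo_def
  proof (rule InterI)
    fix C assume "C \<in> {C. kclone k A C \<and> F \<subseteq> C}"
    then have C: "kclone k A C" "Clo k A F \<subseteq> C" by (auto simp: Clo_def)
    then show "kcompose k A n f gs \<in> C"
      using that by (intro kclone_composeD[OF C(1)]) auto
  qed
  ultimately show ?thesis by (simp add: kclone_def)
qed

section \<open>Operations preserving all invariants of \<open>F\<close> are generated by
  \<open>F\<close>\<close>

lemma Clo_preserves_Inv:
  assumes "F \<subseteq> kops k A" "f \<in> Clo k A F" "\<rho> \<in> Inv k A F"
  shows "kpreserves f \<rho>"
proof -
  have "Clo k A F \<subseteq> {f \<in> kops k A. \<forall>\<rho>\<in>Inv k A F. kpreserves f \<rho>}"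
    by (intro Clo_least kclone_pol) (use assms(1) in \<open>auto simp: Inv_def\<close>)
  then show ?thesis using assms by auto
qed

text \<open>The value tables of the \<open>n\<close>-ary members of the clone form an invariant relation, and the
  table of \<open>f\<close> is the image under \<open>f\<close> of the tables of the projections.\<close>

lemma Pol_Inv_in_Clo:
  assumes "finite A" and F: "F \<subseteq> kops k A" and f: "f \<in> kops k A"
    and pres: "\<And>\<rho>. \<rho> \<in> Inv k A F \<Longrightarrow> kpreserves f \<rho>"
  shows "f \<in> Clo k A F"
proof -
  define n where "n = fst f"
  have n: "1 \<le> n" using kops_arity[OF f] by (simp add: n_def)
  note cl = kclone_Clo[OF F]
  \<comment> \<open>\<open>L\<close> indexes the value tables by pairs of a sort and an argument
    tuple, so a single tuple of the relation records all \<open>k\<close> components of an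
    operation.\<close>
  obtain L where L: "set L = {1..k} \<times> tuples A n"
    using finite_list[of "{1..k} \<times> tuples A n"] finite_tuples[OF \<open>finite A\<close>] by auto
  define tab where "tab g = map (\<lambda>(i, x). snd g i x) L" for g :: "'a kop"
  define \<rho> where "\<rho> = (map fst L, tab ` {g \<in> Clo k A F. fst g = n})"
  have cK: "Clo k A F \<subseteq> kops k A" using cl by (simp add: kclone_def)
  have Lj: "fst (L ! j) \<in> {1..k}" "snd (L ! j) \<in> tuples A n" if "j < length L" for j
    using nth_mem[OF that] L by (auto simp: mem_Times_iff)
  have tab_nth: "tab g ! j = snd g (fst (L ! j)) (snd (L ! j))" if "j < length L" for g j
    using that by (simp add: tab_def case_prod_beta)
  have \<rho>k: "\<rho> \<in> krels k A"
  proof -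
    have "tab g \<in> tuples A (length L)" if "g \<in> kops k A" "fst g = n" for g
      using that kops_in[of g k A] L by (auto simp: tab_def tuples_def)
    then show ?thesis using cK L by (auto simp: \<rho>_def krels_def)
  qed
  have "\<rho> \<in> Inv k A F"
    unfolding Inv_def
  proof (intro CollectI conjI ballI \<rho>k)
    fix h assume h: "h \<in> F"
    show "kpreserves h \<rho>"
      unfolding kpreserves_def
    proof (intro allI impI, elim conjE)
      fix as assume len: "length as = fst h" and as: "set as \<subseteq> snd \<rho>"
      have "\<forall>a\<in>set as. \<exists>g. g \<in> Clo k A F \<and> fst g = n \<and> a = tab g"
        using as unfolding \<rho>_def snd_conv by blast
      then obtain c where c: "\<forall>a\<in>set as. c a \<in> Clo k A F \<and> fst (c a) = n \<and> a = tab (c a)"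
        by metis
      \<comment> \<open>\<open>c\<close> picks an operation for each given table. Applying
        \<open>h\<close> coordinatewise to the tables yields the table of this composition, which
        stays in the clone and is \<open>n\<close>-ary.\<close>
      let ?g = "kcompose k A n h (map c as)"
      have g: "?g \<in> Clo k A F"
      proof -
        have "h \<in> Clo k A F" using h Clo_superset by blast
        moreover have "set (map c as) \<subseteq> Clo k A F" "\<forall>g\<in>set (map c as). fst g = n"
          using c by auto
        ultimately show ?thesis using len by (intro kclone_composeD[OF cl n]) simp_all
      qed
      have "map (\<lambda>j. snd h (fst \<rho> ! j) (map (\<lambda>a. a ! j) as)) [0..<length (fst \<rho>)] = tab ?g"
      proof (rule nth_equalityI)
        show "length (map (\<lambda>j. snd h (fst \<rho> ! j) (map (\<lambda>a. a ! j) as)) [0..<length (fst \<rho>)])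
          = length (tab ?g)" by (simp add: \<rho>_def tab_def)
      next
        fix j assume "j < length (map (\<lambda>j. snd h (fst \<rho> ! j) (map (\<lambda>a. a ! j) as))
          [0..<length (fst \<rho>)])"
        then have j: "j < length L" by (simp add: \<rho>_def)
        have "a ! j = snd (c a) (fst (L ! j)) (snd (L ! j))" if "a \<in> set as" for a
          using tab_nth[OF j, of "c a"] c that by simp
        then have "map (\<lambda>a. a ! j) as = map (\<lambda>a. snd (c a) (fst (L ! j)) (snd (L ! j))) as"
          by (rule map_cong[OF refl])
        then show "map (\<lambda>j. snd h (fst \<rho> ! j) (map (\<lambda>a. a ! j) as)) [0..<length (fst \<rho>)] ! j
          = tab ?g ! j"
          using j Lj[OF j] tab_nth[OF j, of ?g]
          by (simp add: \<rho>_def kcompose_def comp_def del: map_eq_conv)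
      qed
      moreover have "tab ?g \<in> snd \<rho>" using g by (auto simp: \<rho>_def kcompose_def)
      ultimately show "map (\<lambda>j. snd h (fst \<rho> ! j) (map (\<lambda>a. a ! j) as)) [0..<length (fst \<rho>)]
        \<in> snd \<rho>" by simp
    qed
  qed
  then have "kpreserves f \<rho>" by (rule pres)
  \<comment> \<open>\<open>Suc p\<close> because \<open>kproj\<close> counts arguments from
    1.\<close>
  let ?as = "map (\<lambda>p. tab (kproj k A n (Suc p))) [0..<n]"
  have "set ?as \<subseteq> snd \<rho>"
  proof -
    have "kproj k A n (Suc p) \<in> {g \<in> Clo k A F. fst g = n}" if "p < n" for p
      using cl n that by (simp add: kclone_def) (simp add: kproj_def)
    then show ?thesis by (auto simp: \<rho>_def)
  qed
  from kpreservesD[OF \<open>kpreserves f \<rho>\<close> _ this]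
  have "map (\<lambda>j. snd f (fst \<rho> ! j) (map (\<lambda>a. a ! j) ?as)) [0..<length (fst \<rho>)] \<in> snd \<rho>"
    by (simp add: n_def)
  then obtain g where g: "g \<in> Clo k A F" "fst g = n"
    and eq: "map (\<lambda>j. snd f (fst \<rho> ! j) (map (\<lambda>a. a ! j) ?as)) [0..<length (fst \<rho>)] = tab g"
    by (auto simp: \<rho>_def)
  have "f = g"
  proof (rule kop_eqI[OF f])
    show "g \<in> kops k A" using g cK by auto
    show "fst f = fst g" using g by (simp add: n_def)
    fix i xs assume ix: "i \<in> {1..k}" "xs \<in> tuples A (fst f)"
    then have "(i, xs) \<in> set L" using L by (simp add: n_def)
    then obtain j where j: "j < length L" "L ! j = (i, xs)" by (auto simp: in_set_conv_nth)
    have xs: "length xs = n" using ix by (simp add: tuples_def n_def)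
    \<comment> \<open>At the coordinate of \<open>(i, xs)\<close> the projection tables list exactly
      the entries of \<open>xs\<close>, so the image tuple has the entry \<open>snd f i xs\<close>
      there.\<close>
    have "map (\<lambda>a. a ! j) ?as = map (\<lambda>p. xs ! p) [0..<n]"
      using j Lj[OF j(1)] by (auto simp: tab_nth kproj_def)
    also have "\<dots> = xs" using xs map_nth by metis
    finally have "map (\<lambda>a. a ! j) ?as = xs" .
    moreover have "map (\<lambda>j. snd f (fst \<rho> ! j) (map (\<lambda>a. a ! j) ?as)) [0..<length (fst \<rho>)] ! j
      = snd f i (map (\<lambda>a. a ! j) ?as)"
      using j by (simp add: \<rho>_def)
    ultimately show "snd f i xs = snd g i xs" using eq tab_nth[OF j(1), of g] j by simp
  qed
  then show ?thesis using g by simp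
qed

text \<open>Both sides restrict one set by \<open>ksurj\<close>: the operations preserving
  \<open>Inv k A F\<close> are precisely the members of \<open>Clo k A F\<close>.\<close>

lemma sPol_Inv_eq_sClo:
  assumes "finite A" "F \<subseteq> kops k A"
  shows "sPol k A (Inv k A F) = sClo k A F"
proof (intro equalityI subsetI)
  fix f assume "f \<in> sPol k A (Inv k A F)"
  then show "f \<in> sClo k A F"
    using Pol_Inv_in_Clo[OF assms] by (simp add: sPol_def sClo_def)
next
  fix f assume f: "f \<in> sClo k A F"
  moreover have "Clo k A F \<subseteq> kops k A"
    using kclone_Clo[OF assms(2)] by (simp add: kclone_def)
  ultimately show "f \<in> sPol k A (Inv k A F)"
    using Clo_preserves_Inv[OF assms(2)] by (auto simp: sPol_def sClo_def)
qed

section \<open>Definable relations are invariant under surjective polymorphisms\<close>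

text \<open>Positive arity matters: a nullary operation would take the empty list of tuples and have
  to produce a member of the empty relation.\<close>

lemma kpreserves_sigma_bot: "1 \<le> fst f \<Longrightarrow> kpreserves f sigma_bot"
  by (auto simp: kpreserves_def sigma_bot_def)

lemma kpreserves_sigma_eq:
  assumes "f \<in> kops k A" "i \<in> {1..k}"
  shows "kpreserves f (sigma_eq A i)"
  unfolding kpreserves_def
proof (intro allI impI, elim conjE)
  fix as assume len: "length as = fst f" and as: "set as \<subseteq> snd (sigma_eq A i)"
  have "map (\<lambda>a. a ! Suc 0) as = map (\<lambda>a. a ! 0) as"
    using as by (auto simp: sigma_eq_def)
  moreover have "map (\<lambda>a. a ! 0) as \<in> tuples A (fst f)"
    using as len by (force simp: sigma_eq_def tuples_def)
  then have "snd f i (map (\<lambda>a. a ! 0) as) \<in> A" by (rule kops_in[OF assms])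
  ultimately show "map (\<lambda>j. snd f (fst (sigma_eq A i) ! j) (map (\<lambda>a. a ! j) as))
      [0..<length (fst (sigma_eq A i))] \<in> snd (sigma_eq A i)"
    by (simp add: sigma_eq_def upt_rec del: map_eq_conv)
qed

text \<open>Satisfying assignments are combined pointwise, each variable by the component of
  \<open>f\<close> for its sort. An existential witness is the value of \<open>f\<close> at the
  given witnesses; a universal value has a preimage by surjectivity, whose entries are distributed
  over the assignments. The list \<open>vs\<close> is generalised because both quantifier cases
  change the assignments.\<close>

lemma qpp_holds_preserved:
  assumes f: "f \<in> kops k A" "ksurj k A f" and s: "range s \<subseteq> {1..k}"
  assumes "qpp_sorted s \<phi>" "\<forall>\<rho>\<in>qpp_preds \<phi>. kpreserves f \<rho>" "length vs = fst f"
    "\<forall>v\<in>set vs. range v \<subseteq> A \<and> qpp_holds A \<phi> v"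
  shows "qpp_holds A \<phi> (\<lambda>x. snd f (s x) (map (\<lambda>v. v x) vs))"
  using assms(4-7)
proof (induction \<phi> arbitrary: vs)
  case (Atom \<rho> xs)
  have "set (map (\<lambda>v. map v xs) vs) \<subseteq> snd \<rho>" using Atom by auto
  from kpreservesD[OF _ _ this]
  have "map (\<lambda>j. snd f (fst \<rho> ! j) (map (\<lambda>a. a ! j) (map (\<lambda>v. map v xs) vs)))
    [0..<length (fst \<rho>)] \<in> snd \<rho>"
    using Atom by simp
  moreover have "fst \<rho> = map s xs" using Atom by simp
  then have "map (\<lambda>j. snd f (fst \<rho> ! j) (map (\<lambda>a. a ! j) (map (\<lambda>v. map v xs) vs)))
    [0..<length (fst \<rho>)] = map (\<lambda>x. snd f (s x) (map (\<lambda>v. v x) vs)) xs"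
    by (intro nth_equalityI) (auto simp: comp_def)
  ultimately show ?case by simp
next
  case (Conj \<phi> \<psi>)
  then show ?case by simp
next
  case (Exists x \<phi>)
  have "\<forall>v\<in>set vs. \<exists>a. a \<in> A \<and> qpp_holds A \<phi> (v(x := a))" using Exists.prems by auto
  then obtain c where c: "\<forall>v\<in>set vs. c v \<in> A \<and> qpp_holds A \<phi> (v(x := c v))" by metis
  let ?vs = "map (\<lambda>v. v(x := c v)) vs"
  have "qpp_holds A \<phi> (\<lambda>y. snd f (s y) (map (\<lambda>v. v y) ?vs))"
  proof (rule Exists.IH)
    show "\<forall>v\<in>set ?vs. range v \<subseteq> A \<and> qpp_holds A \<phi> v"
      using c Exists.prems by (auto simp: image_subset_iff)
  qed (use Exists.prems in auto)
  also have "(\<lambda>y. snd f (s y) (map (\<lambda>v. v y) ?vs))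
    = (\<lambda>y. snd f (s y) (map (\<lambda>v. v y) vs))(x := snd f (s x) (map c vs))"
    by (auto simp: comp_def)
  finally have "qpp_holds A \<phi> ((\<lambda>y. snd f (s y) (map (\<lambda>v. v y) vs))(x := snd f (s x) (map c vs)))" .
  moreover have "snd f (s x) (map c vs) \<in> A"
    by (rule kops_in[OF f(1)]) (use s c Exists.prems in \<open>auto simp: tuples_def image_subset_iff\<close>)
  ultimately show ?case by auto
next
  case (Forall x \<phi>)
  show ?case
    unfolding qpp_holds.simps
  proof
    fix a assume a: "a \<in> A"
    have "s x \<in> {1..k}" using s by blast
    then have "a \<in> snd f (s x) ` tuples A (fst f)" using f(2) a unfolding ksurj_def by blast
    then obtain bs where bs: "bs \<in> tuples A (fst f)" "snd f (s x) bs = a" by auto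
    then have len: "length bs = length vs" using Forall.prems by (simp add: tuples_def)
    \<comment> \<open>The preimage \<open>bs\<close> of \<open>a\<close> supplies one value of
      \<open>x\<close> per assignment. The universal premise admits all of them, and
      \<open>f\<close> combines them to \<open>a\<close>.\<close>
    let ?vs = "map (\<lambda>(v, b). v(x := b)) (zip vs bs)"
    have "qpp_holds A \<phi> (\<lambda>y. snd f (s y) (map (\<lambda>v. v y) ?vs))"
    proof (rule Forall.IH)
      show "\<forall>v\<in>set ?vs. range v \<subseteq> A \<and> qpp_holds A \<phi> v"
      proof
        fix w assume "w \<in> set ?vs"
        then obtain v b where vb: "(v, b) \<in> set (zip vs bs)" "w = v(x := b)" by auto
        then have "v \<in> set vs" "b \<in> A"
          using bs set_zip_leftD[OF vb(1)] set_zip_rightD[OF vb(1)] by (auto simp: tuples_def)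
        then show "range w \<subseteq> A \<and> qpp_holds A \<phi> w"
          using vb Forall.prems by (auto simp: image_subset_iff)
      qed
    qed (use Forall.prems len in auto)
    also have "(\<lambda>y. snd f (s y) (map (\<lambda>v. v y) ?vs))
      = (\<lambda>y. snd f (s y) (map (\<lambda>v. v y) vs))(x := a)"
    proof
      fix y
      have "map (\<lambda>v. v y) ?vs = (if y = x then bs else map (\<lambda>v. v y) vs)"
        using len by (intro nth_equalityI) auto
      then show "snd f (s y) (map (\<lambda>v. v y) ?vs)
        = ((\<lambda>y. snd f (s y) (map (\<lambda>v. v y) vs))(x := a)) y"
        using bs by simp
    qed
    finally show "qpp_holds A \<phi> ((\<lambda>y. snd f (s y) (map (\<lambda>v. v y) vs))(x := a))" .
  qed
qed

text \<open>Every tuple of a definable relation is read off a satisfying assignment;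
  \<open>f\<close> combines these into a satisfying assignment from which the image tuple is read
  off.\<close>

lemma qpp_closure_subset_Inv_sPol: "qpp_closure k A S \<subseteq> Inv k A (sPol k A S)"
proof
  fix \<rho> assume "\<rho> \<in> qpp_closure k A S"
  then obtain \<phi> s ys where \<rho>: "\<rho> = (map s ys, {map v ys | v. range v \<subseteq> A \<and> qpp_holds A \<phi> v})"
    and s: "range s \<subseteq> {1..k}" "qpp_sorted s \<phi>"
    and preds: "qpp_preds \<phi> \<subseteq> S \<union> {sigma_bot} \<union> sigma_eq A ` {1..k}"
    unfolding qpp_closure_def by blast
  have "\<rho> \<in> krels k A"
    using s(1) by (auto simp: \<rho> krels_def tuples_def image_subset_iff)
  moreover have "kpreserves f \<rho>" if "f \<in> sPol k A S" for f
    unfolding kpreserves_def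
  proof (intro allI impI, elim conjE)
    fix as assume len: "length as = fst f" and as: "set as \<subseteq> snd \<rho>"
    have f: "f \<in> kops k A" "ksurj k A f" "\<forall>\<rho>\<in>S. kpreserves f \<rho>"
      using that by (auto simp: sPol_def)
    have "\<forall>a\<in>set as. \<exists>v. a = map v ys \<and> range v \<subseteq> A \<and> qpp_holds A \<phi> v"
      using as by (auto simp: \<rho>)
    then obtain c where c: "\<forall>a\<in>set as. a = map (c a) ys \<and> range (c a) \<subseteq> A \<and> qpp_holds A \<phi> (c a)"
      by metis
    let ?v = "\<lambda>x. snd f (s x) (map (\<lambda>v. v x) (map c as))"
    have "qpp_holds A \<phi> ?v"
    proof (rule qpp_holds_preserved[OF f(1,2) s])
      show "\<forall>\<rho>\<in>qpp_preds \<phi>. kpreserves f \<rho>"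
        using preds f kpreserves_sigma_bot[OF kops_arity[OF f(1)]] kpreserves_sigma_eq[OF f(1)]
        by blast
    qed (use c len in auto)
    moreover have "?v x \<in> A" for x
      by (rule kops_in[OF f(1)]) (use s c len in \<open>auto simp: tuples_def image_subset_iff\<close>)
    moreover have "map (\<lambda>j. snd f (fst \<rho> ! j) (map (\<lambda>a. a ! j) as)) [0..<length (fst \<rho>)] = map ?v ys"
    proof (rule nth_equalityI)
      fix j assume "j < length (map (\<lambda>j. snd f (fst \<rho> ! j) (map (\<lambda>a. a ! j) as))
        [0..<length (fst \<rho>)])"
      then have j: "j < length ys" by (simp add: \<rho>)
      have "a ! j = c a (ys ! j)" if "a \<in> set as" for a
        using c that j by (metis nth_map)
      then have "map (\<lambda>a. a ! j) as = map (\<lambda>a. c a (ys ! j)) as" by (rule map_cong[OF refl])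
      then show "map (\<lambda>j. snd f (fst \<rho> ! j) (map (\<lambda>a. a ! j) as)) [0..<length (fst \<rho>)] ! j
        = map ?v ys ! j" using j by (simp add: \<rho> comp_def del: map_eq_conv)
    qed (simp add: \<rho>)
    ultimately show "map (\<lambda>j. snd f (fst \<rho> ! j) (map (\<lambda>a. a ! j) as)) [0..<length (fst \<rho>)] \<in> snd \<rho>"
      unfolding \<rho> by auto
  qed
  ultimately show "\<rho> \<in> Inv k A (sPol k A S)" by (simp add: Inv_def)
qed

section \<open>Quantifier blocks, finite conjunctions, finitely many predicates\<close>

lemma qpp_holds_foldr_Exists:
  "qpp_holds A (foldr Exists xs \<phi>) v \<longleftrightarrow>
    (\<exists>w. (\<forall>x\<in>set xs. w x \<in> A) \<and> (\<forall>x. x \<notin> set xs \<longrightarrow> w x = v x) \<and> qpp_holds A \<phi> w)"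
proof (induction xs arbitrary: v)
  case Nil
  have "w = v" if "\<forall>x. w x = v x" for w using that by auto
  then show ?case by auto
next
  case (Cons y ys)
  show ?case
  proof
    assume "qpp_holds A (foldr Exists (y # ys) \<phi>) v"
    then obtain a w where w: "a \<in> A" "\<forall>x\<in>set ys. w x \<in> A"
      "\<forall>x. x \<notin> set ys \<longrightarrow> w x = (v(y := a)) x" "qpp_holds A \<phi> w"
      using Cons.IH by auto
    \<comment> \<open>If \<open>y\<close> occurs again in \<open>ys\<close>, the inner block rebinds
      it and \<open>w y\<close> may differ from \<open>a\<close>.\<close>
    then have "w y \<in> A" by (cases "y \<in> set ys") auto
    then show "\<exists>w. (\<forall>x\<in>set (y # ys). w x \<in> A) \<and> (\<forall>x. x \<notin> set (y # ys) \<longrightarrow> w x = v x) \<and>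
      qpp_holds A \<phi> w"
      using w by (intro exI[of _ w]) auto
  next
    assume "\<exists>w. (\<forall>x\<in>set (y # ys). w x \<in> A) \<and> (\<forall>x. x \<notin> set (y # ys) \<longrightarrow> w x = v x) \<and>
      qpp_holds A \<phi> w"
    then obtain w where w: "\<forall>x\<in>set (y # ys). w x \<in> A" "\<forall>x. x \<notin> set (y # ys) \<longrightarrow> w x = v x"
      "qpp_holds A \<phi> w" by blast
    then have "qpp_holds A (foldr Exists ys \<phi>) (v(y := w y))"
      unfolding Cons.IH by (intro exI[of _ w]) auto
    then show "qpp_holds A (foldr Exists (y # ys) \<phi>) v" using w by auto
  qed
qed

lemma qpp_holds_foldr_Forall:
  "qpp_holds A (foldr Forall xs \<phi>) v \<longleftrightarrow>
    (\<forall>w. (\<forall>x\<in>set xs. w x \<in> A) \<and> (\<forall>x. x \<notin> set xs \<longrightarrow> w x = v x) \<longrightarrow> qpp_holds A \<phi> w)"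
proof (induction xs arbitrary: v)
  case Nil
  have "w = v" if "\<forall>x. w x = v x" for w using that by auto
  then show ?case by auto
next
  case (Cons y ys)
  show ?case
  proof
    assume *: "qpp_holds A (foldr Forall (y # ys) \<phi>) v"
    show "\<forall>w. (\<forall>x\<in>set (y # ys). w x \<in> A) \<and> (\<forall>x. x \<notin> set (y # ys) \<longrightarrow> w x = v x) \<longrightarrow>
      qpp_holds A \<phi> w"
    proof (intro allI impI, elim conjE)
      fix w assume w: "\<forall>x\<in>set (y # ys). w x \<in> A" "\<forall>x. x \<notin> set (y # ys) \<longrightarrow> w x = v x"
      then have "qpp_holds A (foldr Forall ys \<phi>) (v(y := w y))" using * by auto
      then show "qpp_holds A \<phi> w" unfolding Cons.IH using w by auto
    qed
  next
    assume *: "\<forall>w. (\<forall>x\<in>set (y # ys). w x \<in> A) \<and> (\<forall>x. x \<notin> set (y # ys) \<longrightarrow> w x = v x) \<longrightarrow>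
      qpp_holds A \<phi> w"
    have "qpp_holds A (foldr Forall ys \<phi>) (v(y := a))" if a: "a \<in> A" for a
      unfolding Cons.IH
    proof (intro allI impI, elim conjE)
      fix w assume w: "\<forall>x\<in>set ys. w x \<in> A" "\<forall>x. x \<notin> set ys \<longrightarrow> w x = (v(y := a)) x"
      then have "w y \<in> A" using a by (cases "y \<in> set ys") auto
      then show "qpp_holds A \<phi> w" using w by (intro *[rule_format]) auto
    qed
    then show "qpp_holds A (foldr Forall (y # ys) \<phi>) v" by simp
  qed
qed

lemma qpp_foldr_quantifier_simps [simp]:
  "qpp_preds (foldr Exists xs \<phi>) = qpp_preds \<phi>"
  "qpp_preds (foldr Forall xs \<phi>) = qpp_preds \<phi>"
  "qpp_sorted s (foldr Exists xs \<phi>) = qpp_sorted s \<phi>"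
  "qpp_sorted s (foldr Forall xs \<phi>) = qpp_sorted s \<phi>"
  "qpp_free (foldr Exists xs \<phi>) = qpp_free \<phi> - set xs"
  "qpp_free (foldr Forall xs \<phi>) = qpp_free \<phi> - set xs"
  by (induction xs) auto

text \<open>The syntax has no formula for truth, so the conjunction needs a nonempty set and the
  induction starts at singletons.\<close>

lemma qpp_conjunction:
  assumes "finite \<Phi>" "\<Phi> \<noteq> {}"
  obtains \<phi> where "\<And>v. qpp_holds A \<phi> v \<longleftrightarrow> (\<forall>\<psi>\<in>\<Phi>. qpp_holds A \<psi> v)"
    "\<And>s. qpp_sorted s \<phi> \<longleftrightarrow> (\<forall>\<psi>\<in>\<Phi>. qpp_sorted s \<psi>)"
    "qpp_preds \<phi> = (\<Union>\<psi>\<in>\<Phi>. qpp_preds \<psi>)" "qpp_free \<phi> = (\<Union>\<psi>\<in>\<Phi>. qpp_free \<psi>)"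
  using assms
proof (induction arbitrary: thesis rule: finite_ne_induct)
  case (singleton \<psi>)
  show ?case by (rule singleton[of \<psi>]) auto
next
  case (insert \<psi> \<Phi>)
  show ?case
  proof (rule insert.IH)
    fix \<phi>
    assume "\<And>v. qpp_holds A \<phi> v \<longleftrightarrow> (\<forall>\<psi>\<in>\<Phi>. qpp_holds A \<psi> v)"
      "\<And>s. qpp_sorted s \<phi> \<longleftrightarrow> (\<forall>\<psi>\<in>\<Phi>. qpp_sorted s \<psi>)"
      "qpp_preds \<phi> = (\<Union>\<psi>\<in>\<Phi>. qpp_preds \<psi>)" "qpp_free \<phi> = (\<Union>\<psi>\<in>\<Phi>. qpp_free \<psi>)"
    then show ?case by (intro insert.prems[of "Conj \<psi> \<phi>"]) auto
  qed
qed

text \<open>There are finitely many operations of arity \<open>n\<close>, and one violated relation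
  for each that fails to preserve \<open>S\<close> suffices. This keeps the defining formula finite
  even for infinite \<open>S\<close>.\<close>

lemma finite_pol_basis:
  assumes "finite A"
  obtains S0 where "finite S0" "S0 \<subseteq> S"
    "\<And>f. f \<in> kops k A \<Longrightarrow> fst f = n \<Longrightarrow> \<forall>\<rho>\<in>S0. kpreserves f \<rho> \<Longrightarrow> \<forall>\<rho>\<in>S. kpreserves f \<rho>"
proof -
  let ?N = "{f \<in> kops k A. fst f = n \<and> \<not> (\<forall>\<rho>\<in>S. kpreserves f \<rho>)}"
  have "\<forall>f\<in>?N. \<exists>\<rho>. \<rho> \<in> S \<and> \<not> kpreserves f \<rho>" by blast
  from bchoice[OF this] obtain c where c: "\<forall>f\<in>?N. c f \<in> S \<and> \<not> kpreserves f (c f)" ..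
  have fin: "finite ?N" by (rule finite_subset[OF _ finite_kops_arity[OF assms, of k n]]) auto
  show thesis
  proof (rule that[of "c ` ?N"])
    fix f assume "f \<in> kops k A" "fst f = n" and pres: "\<forall>\<rho>\<in>c ` ?N. kpreserves f \<rho>"
    then have "f \<notin> ?N" using c by blast
    then show "\<forall>\<rho>\<in>S. kpreserves f \<rho>" using \<open>f \<in> kops k A\<close> \<open>fst f = n\<close> by blast
  qed (use fin c in blast)+
qed

section \<open>Invariant relations are definable\<close>

text \<open>Empty relations are treated apart because the table construction starts from a tuple of
  the relation. Here \<open>sigma_bot\<close> fails under every assignment, whatever the sorts of
  the listed variables.\<close>

lemma empty_in_qpp_closure:
  assumes "1 \<le> k" "set r \<subseteq> {1..k}"
  shows "(r, {}) \<in> qpp_closure k A S"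
proof -
  \<comment> \<open>Sort 1 is the default for unlisted variables, as \<open>range ?s\<close> must
    stay inside \<open>{1..k}\<close>.\<close>
  let ?s = "\<lambda>j. if j < length r then r ! j else 1"
  have "map ?s [0..<length r] = r" by (intro nth_equalityI) auto
  moreover have "range ?s \<subseteq> {1..k}" using assms nth_mem[of _ r] by force
  ultimately show ?thesis
    unfolding qpp_closure_def
    by (intro CollectI exI[of _ "Atom sigma_bot []"] exI[of _ ?s] exI[of _ "[0..<length r]"])
      (auto simp: sigma_bot_def)
qed

lemma nonempty_Inv_sPol_in_qpp_closure:
  assumes "1 \<le> k" "finite A" "A \<noteq> {}" and S: "S \<subseteq> krels k A"
    and inv: "(r, R) \<in> Inv k A (sPol k A S)" and "R \<noteq> {}"
  shows "(r, R) \<in> qpp_closure k A S"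
proof -
  have r: "set r \<subseteq> {1..k}" and R: "R \<subseteq> tuples A (length r)"
    using inv by (auto simp: Inv_def krels_def)
  have rj: "r ! j \<in> {1..k}" if "j < length r" for j
    using r nth_mem[OF that] by auto
  let ?Z = "{1..k} \<times> A \<rightarrow>\<^sub>E A"
  obtain a0 r0 where a0: "a0 \<in> A" and r0: "r0 \<in> R" using assms(3,6) by auto
  have "finite (R \<times> ?Z)"
    using \<open>finite A\<close> finite_subset[OF R finite_tuples] by (intro finite_cartesian_product finite_PiE) auto
  then obtain L where L: "set L = R \<times> ?Z" by (rule exE[OF finite_list])
  define M where "M = length L"
  \<comment> \<open>With \<open>g\<close> the unknown operation, \<open>col i a\<close> is the
    argument at which its component \<open>i\<close> is later made to take the value
    \<open>a\<close>; applying \<open>g\<close> to the tuples \<open>row j\<close>, in sort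
    \<open>r ! j\<close>, computes the image of the listed tuples of \<open>R\<close>.\<close>
  define col where "col i a = map (\<lambda>(b, z). z (i, a)) L" for i a
  define row where "row j = map (\<lambda>(b, z). b ! j) L" for j
  have col: "col i a \<in> tuples A M" if "i \<in> {1..k}" "a \<in> A" for i a
    using that L by (auto simp: col_def M_def tuples_def PiE_def Pi_def)
  have row_eq: "row j = map (\<lambda>a. a ! j) (map fst L)" for j
    by (simp add: row_def comp_def case_prod_beta)
  have fstL: "set (map fst L) \<subseteq> R" using L by auto
  have row: "row j \<in> tuples A M" if "j < length r" for j
    unfolding row_eq M_def using tuples_map_nth[of "map fst L" A "length r" j] fstL R that by auto
  have Lnth: "\<exists>p<M. L ! p = (b, z)" if "b \<in> R" "z \<in> ?Z" for b z
    using that L by (metis M_def SigmaI in_set_conv_nth)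
  have col_nth: "col i a ! p = z (i, a)" if "p < M" "L ! p = (b, z)" for i a p b z
    using that by (simp add: col_def M_def)
  have row_nth: "row j ! p = b ! j" if "p < M" "L ! p = (b, z)" for j p b z
    using that by (simp add: row_def M_def)
  \<comment> \<open>The position \<open>p0\<close> carries the map sending \<open>(i, a)\<close> to
    \<open>a\<close>, so \<open>col i a ! p0 = a\<close>. It later yields surjectivity, and its
    existence makes the arity \<open>M\<close> positive.\<close>
  have idZ: "(\<lambda>ia\<in>{1..k} \<times> A. snd ia) \<in> ?Z" by auto
  from Lnth[OF r0 idZ] obtain p0 where p0: "p0 < M" "L ! p0 = (r0, \<lambda>ia\<in>{1..k} \<times> A. snd ia)"
    by auto
  then have M: "1 \<le> M" by simp
  obtain S0 where S0: "finite S0" "S0 \<subseteq> S"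
    "\<And>f. f \<in> kops k A \<Longrightarrow> fst f = M \<Longrightarrow> \<forall>\<rho>\<in>S0. kpreserves f \<rho> \<Longrightarrow> \<forall>\<rho>\<in>S. kpreserves f \<rho>"
    using finite_pol_basis[OF \<open>finite A\<close>] by metis

  \<comment> \<open>Variables below \<open>N\<close> are the table entries: \<open>T i x\<close>
    stands for the value of component \<open>i\<close> at \<open>x\<close>, and \<open>d\<close>
    decodes such a variable. The next \<open>length r\<close> variables, \<open>ys\<close>, are the
    coordinates of the defined relation.\<close>
  define V where "V = {1..k} \<times> tuples A M"
  have "finite V" unfolding V_def by (intro finite_cartesian_product finite_tuples \<open>finite A\<close>) auto
  then obtain e where e: "bij_betw e V {0..<card V}" using ex_bij_betw_finite_nat by blast
  define N where "N = card V"
  define T where "T i x = e (i, x)" for i x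
  define d where "d = inv_into V e"
  have dT: "d (T i x) = (i, x)" and TN: "T i x < N" if "i \<in> {1..k}" "x \<in> tuples A M" for i x
  proof -
    have "(i, x) \<in> V" using that by (simp add: V_def)
    then show "d (T i x) = (i, x)" "T i x < N"
      using e by (auto simp: d_def T_def N_def bij_betw_def)
  qed
  have dV: "d n \<in> V" if "n < N" for n
    using that e inv_into_into[of n e V] by (auto simp: d_def N_def bij_betw_def)
  have dV': "fst (d n) \<in> {1..k}" "snd (d n) \<in> tuples A M" if "n < N" for n
    using dV[OF that] by (auto simp: V_def mem_Times_iff)
  have dA: "snd (d n) ! p \<in> A" if "n < N" "p < M" for n p
    using dV'(2)[OF that(1)] that(2) nth_mem[of p "snd (d n)"] by (auto simp: tuples_def)

  define s where "s n = (if n < N then fst (d n) else if n - N < length r then r ! (n - N) else 1)" for n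
  have s_range: "range s \<subseteq> {1..k}"
    using dV' rj \<open>1 \<le> k\<close> by (auto simp: s_def)
  have sT: "s (T i x) = i" if "i \<in> {1..k}" "x \<in> tuples A M" for i x
    using dT[OF that] TN[OF that] by (simp add: s_def)
  define ys where "ys = [N..<N + length r]"
  have s_ys: "map s ys = r" by (intro nth_equalityI) (auto simp: ys_def s_def)

  \<comment> \<open>\<open>G v\<close> is the operation whose value table is stored in the
    assignment \<open>v\<close>.\<close>
  define G where "G v = (M, \<lambda>i\<in>{1..k}. \<lambda>x\<in>tuples A M. v (T i x))" for v :: "nat \<Rightarrow> 'a"
  have G: "G v \<in> kops k A" if "range v \<subseteq> A" for v
    unfolding G_def by (rule kopsI[OF M]) (use that in auto)
  \<comment> \<open>The atom says that \<open>G v\<close> sends the list \<open>as\<close> of tuples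
    of \<open>\<rho>\<close> into \<open>\<rho>\<close>; all these atoms together express that
    \<open>G v\<close> preserves \<open>\<rho>\<close>.\<close>
  define At where "At \<rho> as = Atom \<rho>
    (map (\<lambda>j. T (fst \<rho> ! j) (map (\<lambda>a. a ! j) as)) [0..<length (fst \<rho>)])" for \<rho> :: "'a krel" and as
  define lists where "lists \<rho> = {as. set as \<subseteq> snd \<rho> \<and> length as = M}" for \<rho> :: "'a krel"
  have arg: "fst \<rho> ! j \<in> {1..k}" "map (\<lambda>a. a ! j) as \<in> tuples A M"
    if "\<rho> \<in> S" "as \<in> lists \<rho>" "j < length (fst \<rho>)" for \<rho> as j
    using that S krelsD[of \<rho> k A] tuples_map_nth[of as A "length (fst \<rho>)" j]
    by (auto simp: lists_def)
  have At_G: "(\<forall>as\<in>lists \<rho>. qpp_holds A (At \<rho> as) v) \<longleftrightarrow> kpreserves (G v) \<rho>" if "\<rho> \<in> S" for \<rho> v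
  proof -
    have eq: "map v (map (\<lambda>j. T (fst \<rho> ! j) (map (\<lambda>a. a ! j) as)) [0..<length (fst \<rho>)])
      = map (\<lambda>j. snd (G v) (fst \<rho> ! j) (map (\<lambda>a. a ! j) as)) [0..<length (fst \<rho>)]"
      if "as \<in> lists \<rho>" for as
      using arg[OF \<open>\<rho> \<in> S\<close> that] by (auto simp: G_def)
    have "qpp_holds A (At \<rho> as) v \<longleftrightarrow>
        map (\<lambda>j. snd (G v) (fst \<rho> ! j) (map (\<lambda>a. a ! j) as)) [0..<length (fst \<rho>)] \<in> snd \<rho>"
      if "as \<in> lists \<rho>" for as
      by (simp only: At_def qpp_holds.simps eq[OF that])
    moreover have "as \<in> lists \<rho> \<longleftrightarrow> length as = fst (G v) \<and> set as \<subseteq> snd \<rho>" for as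
      by (auto simp: lists_def G_def)
    ultimately show ?thesis unfolding kpreserves_def by blast
  qed

  define \<Phi>1 where "\<Phi>1 = (\<Union>\<rho>\<in>S0. At \<rho> ` lists \<rho>)"
  \<comment> \<open>These equalities say that \<open>G v\<close> maps the listed tuples of
    \<open>R\<close> to the tuple held by \<open>ys\<close>.\<close>
  define \<Phi>2 where "\<Phi>2 = (\<lambda>j. Atom (sigma_eq A (r ! j)) [T (r ! j) (row j), N + j]) ` {..<length r}"
  \<comment> \<open>A true equation at an arbitrary table entry keeps the conjunction nonempty when
    \<open>\<Phi>1\<close> and \<open>\<Phi>2\<close> are both empty.\<close>
  define triv where "triv = Atom (sigma_eq A 1) [T 1 (replicate M a0), T 1 (replicate M a0)]"
  have rep: "replicate M a0 \<in> tuples A M" using a0 by (auto simp: tuples_def)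
  have fin_lists: "finite (lists \<rho>)" if "\<rho> \<in> S0" for \<rho>
  proof -
    have "snd \<rho> \<subseteq> tuples A (length (fst \<rho>))" using that S0(2) S krelsD(1)[of \<rho> k A] by auto
    then have "finite (snd \<rho>)" using finite_tuples[OF \<open>finite A\<close>] by (rule finite_subset)
    then show ?thesis unfolding lists_def by (rule finite_lists_length_eq)
  qed
  then have "finite (insert triv (\<Phi>1 \<union> \<Phi>2))" using S0(1) by (simp add: \<Phi>1_def \<Phi>2_def)
  then obtain \<phi> where
    holds: "\<And>v. qpp_holds A \<phi> v \<longleftrightarrow> (\<forall>\<psi>\<in>insert triv (\<Phi>1 \<union> \<Phi>2). qpp_holds A \<psi> v)" and
    sorted: "\<And>s. qpp_sorted s \<phi> \<longleftrightarrow> (\<forall>\<psi>\<in>insert triv (\<Phi>1 \<union> \<Phi>2). qpp_sorted s \<psi>)" and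
    preds: "qpp_preds \<phi> = (\<Union>\<psi>\<in>insert triv (\<Phi>1 \<union> \<Phi>2). qpp_preds \<psi>)" and
    free: "qpp_free \<phi> = (\<Union>\<psi>\<in>insert triv (\<Phi>1 \<union> \<Phi>2). qpp_free \<psi>)"
    by (rule qpp_conjunction) auto
  have holds': "qpp_holds A \<phi> v \<longleftrightarrow> (\<forall>\<rho>\<in>S. kpreserves (G v) \<rho>) \<and>
      (\<forall>j<length r. v (T (r ! j) (row j)) = v (N + j))" if v: "range v \<subseteq> A" for v
  proof -
    have "qpp_holds A triv v" using v by (auto simp: triv_def sigma_eq_def)
    moreover have "(\<forall>\<psi>\<in>\<Phi>1. qpp_holds A \<psi> v) \<longleftrightarrow> (\<forall>\<rho>\<in>S0. kpreserves (G v) \<rho>)"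
    proof -
      have "(\<forall>\<psi>\<in>\<Phi>1. qpp_holds A \<psi> v) \<longleftrightarrow> (\<forall>\<rho>\<in>S0. \<forall>as\<in>lists \<rho>. qpp_holds A (At \<rho> as) v)"
        by (simp add: \<Phi>1_def)
      also have "\<dots> \<longleftrightarrow> (\<forall>\<rho>\<in>S0. kpreserves (G v) \<rho>)"
        by (intro ball_cong refl At_G subsetD[OF S0(2)])
      finally show ?thesis .
    qed
    moreover have "(\<forall>\<rho>\<in>S0. kpreserves (G v) \<rho>) \<longleftrightarrow> (\<forall>\<rho>\<in>S. kpreserves (G v) \<rho>)"
      using S0(2,3) G[OF v] by (auto simp: G_def)
    moreover have "(\<forall>\<psi>\<in>\<Phi>2. qpp_holds A \<psi> v) \<longleftrightarrow> (\<forall>j<length r. v (T (r ! j) (row j)) = v (N + j))"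
      using v by (auto simp: \<Phi>2_def sigma_eq_def)
    ultimately show ?thesis unfolding holds by blast
  qed
  have sorted': "qpp_sorted s \<phi>"
  proof -
    have "qpp_sorted s triv" using sT[OF _ rep] \<open>1 \<le> k\<close> by (simp add: triv_def sigma_eq_def)
    moreover have "qpp_sorted s (At \<rho> as)" if "\<rho> \<in> S0" "as \<in> lists \<rho>" for \<rho> as
      using arg[of \<rho> as] that S0(2) sT by (auto simp: At_def intro!: nth_equalityI)
    moreover have "s (N + j) = r ! j" if "j < length r" for j
      using that by (simp add: s_def)
    then have "\<forall>\<psi>\<in>\<Phi>2. qpp_sorted s \<psi>"
      using rj row sT by (auto simp: \<Phi>2_def sigma_eq_def)
    ultimately show ?thesis unfolding sorted \<Phi>1_def by blast
  qed
  have preds': "qpp_preds \<phi> \<subseteq> S \<union> {sigma_bot} \<union> sigma_eq A ` {1..k}"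
    using S0(2) \<open>1 \<le> k\<close> rj by (auto simp: preds triv_def \<Phi>1_def \<Phi>2_def At_def)
  have free': "qpp_free \<phi> \<subseteq> {0..<N} \<union> set ys"
  proof -
    have "qpp_free triv \<subseteq> {0..<N}" using TN[OF _ rep] \<open>1 \<le> k\<close> by (simp add: triv_def)
    moreover have "qpp_free (At \<rho> as) \<subseteq> {0..<N}" if "\<rho> \<in> S0" "as \<in> lists \<rho>" for \<rho> as
      using arg[of \<rho> as] that S0(2) TN by (auto simp: At_def)
    moreover have "\<forall>\<psi>\<in>\<Phi>2. qpp_free \<psi> \<subseteq> {0..<N} \<union> set ys"
      using TN rj row by (auto simp: \<Phi>2_def ys_def)
    ultimately show ?thesis unfolding free \<Phi>1_def by blast
  qed

  define Q where "Q = {T i (col i a) | i a. i \<in> {1..k} \<and> a \<in> A}"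
  define us where "us = filter (\<lambda>n. n \<in> Q) [0..<N]"
  define es where "es = filter (\<lambda>n. n \<notin> Q) [0..<N]"
  have QN: "n < N" if "n \<in> Q" for n using that TN col by (auto simp: Q_def)
  have us: "set us = Q" using QN by (auto simp: us_def)
  have es: "set es = {n. n < N \<and> n \<notin> Q}" by (auto simp: es_def)
  \<comment> \<open>The universal block is outermost, so the remaining entries may depend on the
    values chosen on \<open>Q\<close>. All table entries become bound, leaving only
    \<open>ys\<close> free.\<close>
  define \<theta> where "\<theta> = foldr Forall us (foldr Exists es \<phi>)"
  have theta: "qpp_holds A \<theta> v \<longleftrightarrow>
    (\<forall>w. (\<forall>n\<in>Q. w n \<in> A) \<and> (\<forall>n. n \<notin> Q \<longrightarrow> w n = v n) \<longrightarrow>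
      (\<exists>w'. (\<forall>n<N. n \<notin> Q \<longrightarrow> w' n \<in> A) \<and> (\<forall>n. N \<le> n \<or> n \<in> Q \<longrightarrow> w' n = w n) \<and> qpp_holds A \<phi> w'))"
    for v
    unfolding \<theta>_def qpp_holds_foldr_Forall qpp_holds_foldr_Exists us es
    by (simp add: not_less imp_conjL disj_imp)
  have "{map v ys | v. range v \<subseteq> A \<and> qpp_holds A \<theta> v} = R"
  proof (intro equalityI subsetI)
    fix b assume "b \<in> {map v ys | v. range v \<subseteq> A \<and> qpp_holds A \<theta> v}"
    then obtain v where b: "b = map v ys" and v: "range v \<subseteq> A" "qpp_holds A \<theta> v" by blast
    \<comment> \<open>The universal entries are instantiated as in the table of the projection to
      position \<open>p0\<close>, which gives the value \<open>a\<close> at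
      \<open>col i a\<close>.\<close>
    define w where "w n = (if n \<in> Q then snd (d n) ! p0 else v n)" for n
    have w: "(\<forall>n\<in>Q. w n \<in> A) \<and> (\<forall>n. n \<notin> Q \<longrightarrow> w n = v n)"
      using dA[OF QN p0(1)] by (auto simp: w_def)
    from v(2)[unfolded theta, THEN spec, THEN mp, OF w]
    obtain w' where w': "\<forall>n<N. n \<notin> Q \<longrightarrow> w' n \<in> A"
      "\<forall>n. N \<le> n \<or> n \<in> Q \<longrightarrow> w' n = w n" "qpp_holds A \<phi> w'"
      by (elim exE conjE)
    have w'A: "w' n \<in> A" for n
    proof (cases "N \<le> n \<or> n \<in> Q")
      case True
      then have "w' n = w n" using w' by blast
      then show ?thesis using v(1) dA[OF QN p0(1)] by (auto simp: w_def)
    qed (use w' in auto)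
    then have w'r: "range w' \<subseteq> A" by auto
    have surj: "snd (G w') i (col i a) = a" if "i \<in> {1..k}" "a \<in> A" for i a
    proof -
      have "T i (col i a) \<in> Q" using that by (auto simp: Q_def)
      then have "w' (T i (col i a)) = col i a ! p0"
        using w'(2) dT[OF that(1) col[OF that]] by (simp add: w_def)
      also have "\<dots> = a" using col_nth[OF p0] that by simp
      finally show ?thesis using that col[OF that] by (simp add: G_def)
    qed
    have "ksurj k A (G w')"
      unfolding ksurj_def
    proof (intro ballI equalityI subsetI)
      fix i a assume i: "i \<in> {1..k}" and "a \<in> snd (G w') i ` tuples A (fst (G w'))"
      then show "a \<in> A" using w'A by (auto simp: G_def)
    next
      fix i a assume i: "i \<in> {1..k}" and a: "a \<in> A"
      show "a \<in> snd (G w') i ` tuples A (fst (G w'))"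
        using surj[OF i a] col[OF i a] by (intro image_eqI[of _ _ "col i a"]) (auto simp: G_def)
    qed
    \<comment> \<open>The values on \<open>Q\<close> already force surjectivity, however the
      existential entries were chosen. Invariance of \<open>(r, R)\<close> therefore applies to
      \<open>G w'\<close>.\<close>
    then have "G w' \<in> sPol k A S" using G[OF w'r] w'(3) holds'[OF w'r] by (simp add: sPol_def)
    then have "kpreserves (G w') (r, R)" using inv by (simp add: Inv_def)
    from kpreservesD[OF this, of "map fst L"] fstL
    have "map (\<lambda>j. snd (G w') (r ! j) (row j)) [0..<length r] \<in> R"
      unfolding row_eq by (simp add: G_def M_def)
    also have "map (\<lambda>j. snd (G w') (r ! j) (row j)) [0..<length r] = b"
    proof (rule nth_equalityI)
      fix j assume "j < length (map (\<lambda>j. snd (G w') (r ! j) (row j)) [0..<length r])"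
      then have j: "j < length r" by simp
      have "N + j \<notin> Q" using QN by fastforce
      then have "w' (T (r ! j) (row j)) = v (N + j)"
        using w' holds'[OF w'r] j by (simp add: w_def)
      then show "map (\<lambda>j. snd (G w') (r ! j) (row j)) [0..<length r] ! j = b ! j"
        using j rj[OF j] row[OF j] by (simp add: G_def b ys_def)
    qed (simp add: b ys_def)
    finally show "b \<in> R" .
  next
    fix b assume bR: "b \<in> R"
    then have bl: "length b = length r" "set b \<subseteq> A" using R by (auto simp: tuples_def)
    define v where "v n = (if n < N then a0 else if n - N < length r then b ! (n - N) else a0)" for n
    have bA: "b ! j \<in> A" if "j < length r" for j using bl nth_mem[of j b] that by auto
    have vA: "v n \<in> A" for n using a0 bA by (simp add: v_def)
    have "b = map v ys" using bl by (intro nth_equalityI) (auto simp: ys_def v_def)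
    moreover have "qpp_holds A \<theta> v"
      unfolding theta
    proof (intro allI impI, elim conjE)
      fix w assume w: "\<forall>n\<in>Q. w n \<in> A" "\<forall>n. n \<notin> Q \<longrightarrow> w n = v n"
      have wA: "w n \<in> A" for n using w vA by (cases "n \<in> Q") auto
      \<comment> \<open>\<open>z\<close> records the arbitrary values on \<open>Q\<close>. Since
        \<open>L\<close> pairs \<open>b\<close> with every map, some position \<open>p\<close>
        carries \<open>(b, z)\<close>.\<close>
      define z where "z = (\<lambda>(i, a)\<in>{1..k} \<times> A. w (T i (col i a)))"
      have "z \<in> ?Z" using wA by (auto simp: z_def)
      from Lnth[OF bR this] obtain p where p: "p < M" "L ! p = (b, z)" by auto
      \<comment> \<open>The existential entries are filled with the table of the projection to
        position \<open>p\<close>: it agrees with \<open>w\<close> on \<open>Q\<close> by the choice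
        of \<open>z\<close>, and sends the listed tuples of \<open>R\<close> to
        \<open>b\<close>.\<close>
      define w' where "w' n = (if n < N then snd (d n) ! p else w n)" for n
      have w'T: "w' (T i x) = x ! p" if "i \<in> {1..k}" "x \<in> tuples A M" for i x
        using dT[OF that] TN[OF that] by (simp add: w'_def)
      have w'A: "w' n \<in> A" for n using wA dA p by (simp add: w'_def)
      have w'N: "w' n = w n" if "N \<le> n" for n using that by (simp add: w'_def)
      have w'Q: "w' n = w n" if nQ: "n \<in> Q" for n
      proof -
        obtain i a where n: "n = T i (col i a)" and ia: "i \<in> {1..k}" "a \<in> A"
          using nQ by (auto simp: Q_def)
        show ?thesis unfolding n w'T[OF ia(1) col[OF ia]] col_nth[OF p] using ia by (simp add: z_def)
      qed
      have Gp: "G w' = kproj k A M (Suc p)"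
        by (auto simp: G_def kproj_def w'T intro!: ext)
      have "kpreserves (G w') \<rho>" if "\<rho> \<in> S" for \<rho>
        unfolding Gp by (rule kproj_preserves[of _ k A]) (use that S p in auto)
      moreover have "w' (T (r ! j) (row j)) = w' (N + j)" if j: "j < length r" for j
      proof -
        have "N + j \<notin> Q" using QN by fastforce
        then show ?thesis
          using w'T[OF rj[OF j] row[OF j]] row_nth[OF p] w j by (simp add: w'_def v_def)
      qed
      ultimately have "qpp_holds A \<phi> w'" using holds'[of w'] w'A by auto
      then show "\<exists>w'. (\<forall>n<N. n \<notin> Q \<longrightarrow> w' n \<in> A) \<and> (\<forall>n. N \<le> n \<or> n \<in> Q \<longrightarrow> w' n = w n) \<and>
          qpp_holds A \<phi> w'"
        using w'A w'Q w'N by blast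
    qed
    ultimately show "b \<in> {map v ys | v. range v \<subseteq> A \<and> qpp_holds A \<theta> v}" using vA by blast
  qed
  moreover have "qpp_sorted s \<theta>" using sorted' by (simp add: \<theta>_def)
  moreover have "qpp_preds \<theta> \<subseteq> S \<union> {sigma_bot} \<union> sigma_eq A ` {1..k}"
    using preds' by (simp add: \<theta>_def)
  moreover have "qpp_free \<theta> \<subseteq> set ys" using free' us es by (auto simp: \<theta>_def)
  moreover have "distinct ys" by (simp add: ys_def)
  ultimately show ?thesis unfolding qpp_closure_def using s_range s_ys by blast
qed

lemma Inv_sPol_eq_qpp_closure:
  assumes "1 \<le> k" "finite A" "A \<noteq> {}" "S \<subseteq> krels k A"
  shows "Inv k A (sPol k A S) = qpp_closure k A S"
proof
  show "Inv k A (sPol k A S) \<subseteq> qpp_closure k A S"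
  proof
    fix \<rho> assume \<rho>: "\<rho> \<in> Inv k A (sPol k A S)"
    show "\<rho> \<in> qpp_closure k A S"
    proof (cases "snd \<rho> = {}")
      case True
      then have "\<rho> = (fst \<rho>, {})" by (simp add: prod_eq_iff)
      moreover have "set (fst \<rho>) \<subseteq> {1..k}" using \<rho> by (auto simp: Inv_def krels_def)
      ultimately show ?thesis using empty_in_qpp_closure[OF assms(1)] by metis
    next
      case False
      then show ?thesis using nonempty_Inv_sPol_in_qpp_closure[OF assms, of "fst \<rho>" "snd \<rho>"] \<rho>
        by simp
    qed
  qed
qed (rule qpp_closure_subset_Inv_sPol)

text \<open>Two statements about \<open>F\<close> carry a surjectivity premise because
  \<open>sPol\<close> contains surjective operations only. Without it they can fail: if
  \<open>k = 1\<close>, \<open>A\<close> has two elements and \<open>F\<close> consists of one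
  constant operation, then \<open>sClo k A F\<close> contains just the projections, whose invariants
  are all of \<open>krels k A\<close>, whereas the constant violates a singleton unary
  relation.\<close>

theorem theorem2p8:
  fixes k :: nat and A :: "'a set"
    and F F' :: "'a kop set" and S S' :: "'a krel set"
  assumes "k \<ge> 1" and "finite A" and "A \<noteq> {}"
    and "F' \<subseteq> F" and "F \<subseteq> kops k A"
    and "S' \<subseteq> S" and "S \<subseteq> krels k A"
  shows "Inv k A F \<subseteq> Inv k A F' \<and>
    ((\<forall>f\<in>F. ksurj k A f) \<longrightarrow>
       F \<subseteq> sPol k A (Inv k A F) \<and>
       Inv k A (sPol k A (Inv k A F)) = Inv k A F) \<and>
    sPol k A S \<subseteq> sPol k A S' \<and>
    S \<subseteq> Inv k A (sPol k A S) \<and>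
    sPol k A (Inv k A (sPol k A S)) = sPol k A S \<and>
    sPol k A (Inv k A F) = sClo k A F \<and>
    Inv k A (sPol k A S) = qpp_closure k A S"
proof -
  note sub = \<open>F' \<subseteq> F\<close> \<open>F \<subseteq> kops k A\<close> \<open>S' \<subseteq> S\<close> \<open>S \<subseteq> krels k A\<close>
  have SI: "S \<subseteq> Inv k A (sPol k A S)" using sub by (auto simp: Inv_def sPol_def)
  have FI: "F \<subseteq> sPol k A (Inv k A F)" if "\<forall>f\<in>F. ksurj k A f"
    using that sub by (auto simp: Inv_def sPol_def)
  have "Inv k A F \<subseteq> Inv k A F'" "sPol k A S \<subseteq> sPol k A S'"
    using sub by (auto simp: Inv_def sPol_def)
  moreover have "Inv k A (sPol k A (Inv k A F)) = Inv k A F" if "\<forall>f\<in>F. ksurj k A f"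
  proof
    show "Inv k A (sPol k A (Inv k A F)) \<subseteq> Inv k A F"
      using FI[OF that] by (auto simp: Inv_def)
  qed (auto simp: Inv_def sPol_def)
  moreover have "sPol k A (Inv k A (sPol k A S)) = sPol k A S"
  proof
    show "sPol k A (Inv k A (sPol k A S)) \<subseteq> sPol k A S"
      using SI by (auto simp: sPol_def)
  qed (auto simp: Inv_def sPol_def)
  ultimately show ?thesis
    using SI FI sPol_Inv_eq_sClo[OF assms(2,5)] Inv_sPol_eq_qpp_closure[OF assms(1-3,7)] by blast
qed

end
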